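(* There is a constant $c_0>0$ such that the following holds. Let $d(1),\dots,d(m)$ be the degree sequence of an Erdős–Rényi graph $\mathbb G(m,\rho)$, and let $\overline d=\frac1m\sum_i d(i)$. If $\frac{\log m}m\le\rho\le1$, then $$\mathbb P\left[\sum_i\frac{|d(i)-(m-1)\rho|}{m(m-1)\rho}\ge\frac{c_0}{\sqrt{(m-1)\rho}}\right]\le e^{-\frac m{c_0}}$$ and $$\mathbb P\left[\sum_i\frac{|d(i)-\overline d|}{m\overline d}\ge\frac{c_0}{\sqrt{(m-1)\rho}}\right]\le e^{-\frac m{c_0}}.$$
   Context: For a positive integer $m$ and $\rho\in[0,1]$, the Erdős–Rényi graph $\mathbb G(m,\rho)$ is the random graph on $m$ vertices in which each unoriented edge $\{s,t\}$ with $s\ne t$ occurs independently with probability $\rho$. $d(i)$ is the number of edges at vertex $i$. *)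

theory Defs
  imports "HOL-Probability.Probability"
begin

definition all_edges :: "nat \<Rightarrow> nat set set" where
  "all_edges m = {{s, t} | s t. s \<in> {1..m} \<and> t \<in> {1..m} \<and> s \<noteq> t}"

text \<open>
  The law of the Erdos-Renyi graph with vertex set \<open>{1..m}\<close>, a graph being given by
  its set of edges: one independent Bernoulli variable per unordered pair decides whether
  that pair is an edge.  Note that \<open>bernoulli_pmf\<close> clips a parameter outside
  \<open>[0, 1]\<close> to that interval.
\<close>

definition erdos_renyi :: "nat \<Rightarrow> real \<Rightarrow> nat set set pmf" where
  "erdos_renyi m \<rho> =
     map_pmf (\<lambda>X. {e \<in> all_edges m. X e})
       (Pi_pmf (all_edges m) False (\<lambda>_. bernoulli_pmf \<rho>))"

definition vertex_degree :: "nat set set \<Rightarrow> nat \<Rightarrow> nat" where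
  "vertex_degree G i = card {e \<in> G. i \<in> e}"

definition avg_degree :: "nat \<Rightarrow> nat set set \<Rightarrow> real" where
  "avg_degree m G = (\<Sum>i = 1..m. real (vertex_degree G i)) / real m"

text \<open>
  A deviation from the average degree relative to that average is undefined (0/0) for the
  edgeless graph.  Division by zero yields 0, so the edgeless graph counts as having
  deviation 0, as is natural since its degrees are all equal to the average.
\<close>

end

theory Submission
  imports Defs
begin

text \<open>
  Write \<open>q = (m - 1)\<rho>\<close> for the mean degree and \<open>S = (\<Sum>i. \<bar>d(i) - q\<bar>)\<close>.  The first claim says
  that \<open>S \<ge> c m \<surd>q\<close> is exponentially unlikely in \<open>m\<close>.  The degrees are dependent, but \<open>S\<close> is the
  maximum over all sign patterns \<open>\<epsilon>\<close> of \<open>(\<Sum>i. \<epsilon>\<^sub>i (d(i) - q))\<close>, and for a fixed pattern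
  double counting turns this into a sum over the independent edges, in which the edge \<open>{s, t}\<close> has
  weight \<open>\<epsilon>\<^sub>s + \<epsilon>\<^sub>t\<close> (\<open>sum_weighted_degree_deviation\<close>).  The exponential moment of such
  a weighted sum, with exponent \<open>\<theta>\<close>, is at most
  \<open>exp (4 \<theta>\<^sup>2 \<rho> m(m - 1)/2) = exp (2 \<theta>\<^sup>2 m q)\<close>
  (\<open>erdos_renyi_chernoff\<close>).  Taking \<open>\<theta>\<close> of order \<open>1 / \<surd>q\<close> makes this
  \<open>exp (O(m))\<close>, and the threshold \<open>c m \<surd>q\<close> then contributes a factor \<open>exp (- const c m)\<close>,
  which for large \<open>c\<close> also pays for the union bound over the \<open>2 ^ m\<close> sign patterns
  (\<open>total_degree_deviation_tail\<close>).  The moment bound needs \<open>\<theta>\<close> bounded, that is \<open>q\<close>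
  bounded below, and this is what the assumption \<open>\<rho> \<ge> log m / m\<close> is used for
  (\<open>mean_degree_ge_quarter\<close>).

  For the second claim, the average degree differs from \<open>q\<close> by at most \<open>S / m\<close>, so replacing \<open>q\<close>
  by the average at most doubles the sum of deviations.  Unless the average degree is below \<open>q / 2\<close>,
  the normalisation costs another factor \<open>2\<close>, and the first bound applies with a smaller constant
  (\<open>avg_degree_deviation_le\<close>).  The exceptional event says that the number of edges is less than half
  its mean, which has probability at most \<open>exp (- m q / 32)\<close> (\<open>avg_degree_lower_tail\<close>),
  again exponentially small in \<open>m\<close> because \<open>q\<close> is bounded below.
\<close>

section \<open>Exponential moments of edge sums\<close>

lemma exp_le_quadratic:
  fixes x :: real
  assumes "x \<le> 1"
  shows "exp x \<le> 1 + x + x\<^sup>2"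
proof (cases "x \<ge> 0")
  case True
  then show ?thesis using assms exp_bound by blast
next
  case False
  define y where "y = - x"
  have y: "y > 0" using False by (simp add: y_def)
  \<comment> \<open>Bound \<open>exp y\<close> below by its quadratic Taylor polynomial and multiply by the claimed bound for \<open>exp (- y)\<close>.\<close>
  have "1 \<le> 1 + y\<^sup>2 / 2 + y ^ 3 / 2 + y ^ 4 / 2" using y by simp
  also have "\<dots> = (1 - y + y\<^sup>2) * (1 + y + y\<^sup>2 / 2)"
    by (simp add: power2_eq_square power3_eq_cube eval_nat_numeral field_simps)
  also have "\<dots> \<le> (1 - y + y\<^sup>2) * exp y"
  proof (rule mult_left_mono)
    show "1 + y + y\<^sup>2 / 2 \<le> exp y" using exp_lower_Taylor_quadratic[of y] y by simp
    have "1 - y + y\<^sup>2 = (y - 1 / 2)\<^sup>2 + 3 / 4" by (simp add: power2_eq_square algebra_simps)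
    then show "0 \<le> 1 - y + y\<^sup>2" by (smt (verit) zero_le_power2 divide_nonneg_nonneg)
  qed
  finally have "exp (- y) \<le> 1 - y + y\<^sup>2" by (simp add: exp_minus field_simps)
  then show ?thesis by (simp add: y_def)
qed

text \<open>
  The factor \<open>\<rho>\<close> in the exponent reflects that the variance is at most \<open>\<rho>\<close>; a Hoeffding bound,
  which only sees the range of the variable, would lose it, and with it the scale \<open>\<surd>q\<close> of the
  degree fluctuations in sparse graphs.
\<close>

lemma bernoulli_centred_mgf_le:
  fixes u \<rho> :: real
  assumes "0 \<le> \<rho>" "\<rho> \<le> 1" "u \<le> 1"
  shows "measure_pmf.expectation (bernoulli_pmf \<rho>) (\<lambda>b. exp (u * (of_bool b - \<rho>)))
           \<le> exp (\<rho> * u\<^sup>2)"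
proof -
  have "measure_pmf.expectation (bernoulli_pmf \<rho>) (\<lambda>b. exp (u * (of_bool b - \<rho>)))
      = \<rho> * exp (u * (1 - \<rho>)) + (1 - \<rho>) * exp (- (u * \<rho>))"
    using assms by (simp add: algebra_simps)
  also have "\<dots> = exp (- (u * \<rho>)) * (1 + \<rho> * (exp u - 1))"
    by (simp add: algebra_simps exp_diff exp_minus field_simps)
  also have "\<dots> \<le> exp (- (u * \<rho>)) * exp (\<rho> * (exp u - 1))"
    by (intro mult_left_mono exp_ge_add_one_self) auto
  also have "\<dots> = exp (\<rho> * (exp u - 1 - u))"
    by (simp add: exp_add[symmetric] algebra_simps)
  also have "\<dots> \<le> exp (\<rho> * u\<^sup>2)"
    using exp_le_quadratic[OF assms(3)] assms(1) by (auto intro!: mult_left_mono)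
  finally show ?thesis .
qed

lemma all_edges_iff: "e \<in> all_edges m \<longleftrightarrow> e \<subseteq> {1..m} \<and> card e = 2"
proof
  assume "e \<in> all_edges m"
  then show "e \<subseteq> {1..m} \<and> card e = 2" by (auto simp: all_edges_def)
next
  assume e: "e \<subseteq> {1..m} \<and> card e = 2"
  then obtain s t where "e = {s, t}" "s \<noteq> t" by (meson card_2_iff)
  then show "e \<in> all_edges m" using e unfolding all_edges_def by blast
qed

lemma finite_all_edges: "finite (all_edges m)"
  by (rule finite_subset[of _ "Pow {1..m}"]) (use all_edges_iff in auto)

lemma set_erdos_renyi: "set_pmf (erdos_renyi m \<rho>) \<subseteq> Pow (all_edges m)"
  by (auto simp: erdos_renyi_def)

text \<open>
  Chernoff's method with the exponential parameter absorbed into the weights \<open>w\<close>: Markov's inequality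
  for the exponential of the sum, which by independence has as expectation a product over the edges.
  Negative weights give lower tails.
\<close>

lemma erdos_renyi_chernoff:
  fixes w :: "nat set \<Rightarrow> real"
  assumes \<rho>: "0 \<le> \<rho>" "\<rho> \<le> 1" and w: "\<And>e. e \<in> all_edges m \<Longrightarrow> w e \<le> 1"
  shows "measure_pmf.prob (erdos_renyi m \<rho>)
           {G. (\<Sum>e\<in>all_edges m. w e * (of_bool (e \<in> G) - \<rho>)) \<ge> t}
         \<le> exp (\<rho> * (\<Sum>e\<in>all_edges m. (w e)\<^sup>2) - t)"
proof -
  let ?E = "all_edges m"
  let ?B = "Pi_pmf ?E False (\<lambda>_. bernoulli_pmf \<rho>)"
  let ?Z = "\<lambda>X. \<Sum>e\<in>?E. w e * (of_bool (X e) - \<rho>)"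
  have int: "integrable (measure_pmf ?B) f" for f :: "_ \<Rightarrow> real"
    by (rule integrable_measure_pmf_finite)
       (rule finite_subset[OF set_Pi_pmf_subset'[OF finite_all_edges]],
        auto intro!: finite_PiE_dflt finite_all_edges)
  have "measure_pmf.prob (erdos_renyi m \<rho>) {G. (\<Sum>e\<in>?E. w e * (of_bool (e \<in> G) - \<rho>)) \<ge> t}
      = measure_pmf.prob ?B {X. exp t \<le> exp (?Z X)}"
    unfolding erdos_renyi_def measure_map_pmf vimage_def
    by (intro arg_cong[where f = "measure_pmf.prob ?B"] Collect_cong) 
       (auto intro!: arg_cong[where f = "\<lambda>x. t \<le> x"] sum.cong)
  also have "\<dots> \<le> measure_pmf.expectation ?B (\<lambda>X. exp (?Z X)) / exp t"
    using integral_Markov_inequality_measure[OF int, of UNIV "\<lambda>X. exp (?Z X)" "exp t"] by simp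
  also have "measure_pmf.expectation ?B (\<lambda>X. exp (?Z X))
      = measure_pmf.expectation ?B (\<lambda>X. \<Prod>e\<in>?E. exp (w e * (of_bool (X e) - \<rho>)))"
    by (simp add: exp_sum finite_all_edges)
  also have "\<dots> = (\<Prod>e\<in>?E. measure_pmf.expectation (bernoulli_pmf \<rho>)
                      (\<lambda>b. exp (w e * (of_bool b - \<rho>))))"
    by (rule expectation_prod_Pi_pmf) (auto simp: finite_all_edges intro!: integrable_measure_pmf_finite)
  also have "\<dots> \<le> (\<Prod>e\<in>?E. exp (\<rho> * (w e)\<^sup>2))"
    using \<rho> w by (intro prod_mono conjI bernoulli_centred_mgf_le integral_nonneg_AE) auto
  also have "\<dots> = exp (\<rho> * (\<Sum>e\<in>?E. (w e)\<^sup>2))"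
    by (simp add: exp_sum finite_all_edges sum_distrib_left)
  finally show ?thesis by (simp add: exp_diff divide_right_mono)
qed

section \<open>From degrees to edges\<close>

text \<open>Double counting of the incidences \<open>i \<in> e\<close>, weighted by \<open>a i\<close>.\<close>

lemma sum_vertex_degree:
  fixes a :: "nat \<Rightarrow> real"
  assumes "G \<subseteq> all_edges m"
  shows "(\<Sum>i=1..m. a i * real (vertex_degree G i)) = (\<Sum>e\<in>G. \<Sum>i\<in>e. a i)"
proof -
  have fin: "finite G" using assms finite_all_edges finite_subset by blast
  have "(\<Sum>i=1..m. a i * real (vertex_degree G i)) = (\<Sum>i=1..m. \<Sum>e\<in>G. if i \<in> e then a i else 0)"
    using fin by (simp add: vertex_degree_def sum.If_cases Int_def mult.commute)
  also have "\<dots> = (\<Sum>e\<in>G. \<Sum>i=1..m. if i \<in> e then a i else 0)"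
    by (rule sum.swap)
  also have "\<dots> = (\<Sum>e\<in>G. \<Sum>i\<in>e. a i)"
  proof (rule sum.cong[OF refl])
    fix e assume "e \<in> G"
    then have "{1..m} \<inter> e = e" using assms all_edges_iff by blast
    then show "(\<Sum>i=1..m. if i \<in> e then a i else 0) = (\<Sum>i\<in>e. a i)"
      by (simp add: sum.If_cases)
  qed
  finally show ?thesis .
qed

lemma vertex_degree_complete:
  assumes "i \<in> {1..m}"
  shows "vertex_degree (all_edges m) i = m - 1"
proof -
  have "{e \<in> all_edges m. i \<in> e} = (\<lambda>j. {i, j}) ` ({1..m} - {i})"
  proof (intro equalityI subsetI)
    fix e assume "e \<in> (\<lambda>j. {i, j}) ` ({1..m} - {i})"
    then obtain j where "j \<in> {1..m}" "j \<noteq> i" "e = {i, j}" by blast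
    then show "e \<in> {e \<in> all_edges m. i \<in> e}" using assms by (simp add: all_edges_iff)
  qed (auto simp: all_edges_def)
  moreover have "inj_on (\<lambda>j. {i, j}) ({1..m} - {i})"
    by (auto simp: inj_on_def doubleton_eq_iff)
  ultimately show ?thesis
    using assms by (simp add: vertex_degree_def card_image)
qed

text \<open>
  The left side is a combination of dependent variables, the right side one of independent centred
  variables.  The centring terms agree because \<open>m - 1\<close> is the degree of \<open>i\<close> in the complete graph,
  to which the double counting applies as well.
\<close>

lemma sum_weighted_degree_deviation:
  fixes a :: "nat \<Rightarrow> real"
  assumes G: "G \<subseteq> all_edges m"
  shows "(\<Sum>i=1..m. a i * (real (vertex_degree G i) - (real m - 1) * \<rho>))
       = (\<Sum>e\<in>all_edges m. (\<Sum>i\<in>e. a i) * (of_bool (e \<in> G) - \<rho>))"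
proof -
  have "(\<Sum>i=1..m. a i * (real (vertex_degree G i) - (real m - 1) * \<rho>))
      = (\<Sum>i=1..m. a i * real (vertex_degree G i))
        - (\<Sum>i=1..m. a i * real (vertex_degree (all_edges m) i)) * \<rho>"
    unfolding sum_distrib_right sum_subtractf[symmetric]
    by (intro sum.cong refl) (auto simp: vertex_degree_complete of_nat_diff algebra_simps)
  also have "\<dots> = (\<Sum>e\<in>G. \<Sum>i\<in>e. a i) - (\<Sum>e\<in>all_edges m. \<Sum>i\<in>e. a i) * \<rho>"
    by (simp only: sum_vertex_degree[OF G] sum_vertex_degree[OF order.refl])
  also have "(\<Sum>e\<in>G. \<Sum>i\<in>e. a i) = (\<Sum>e\<in>all_edges m. (\<Sum>i\<in>e. a i) * of_bool (e \<in> G))"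
    using G by (intro sum.mono_neutral_cong_left finite_all_edges) auto
  finally show ?thesis
    by (simp only: sum_distrib_right sum_subtractf right_diff_distrib)
qed

lemma sum_vertex_degree_eq_edges:
  assumes "G \<subseteq> all_edges m"
  shows "(\<Sum>i=1..m. real (vertex_degree G i)) = 2 * real (card G)"
proof -
  have "(\<Sum>i=1..m. real (vertex_degree G i)) = (\<Sum>e\<in>G. \<Sum>i\<in>e. 1)"
    using sum_vertex_degree[OF assms, of "\<lambda>_. 1"] by simp
  also have "\<dots> = (\<Sum>e\<in>G. 2)"
    using assms by (intro sum.cong) (auto simp: all_edges_iff)
  finally show ?thesis by simp
qed

lemma card_all_edges: "real (card (all_edges m)) = real m * (real m - 1) / 2"
proof -
  have "2 * real (card (all_edges m)) = (\<Sum>i=1..m. real (m - 1))"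
    using sum_vertex_degree_eq_edges[of "all_edges m" m] by (simp add: vertex_degree_complete)
  then show ?thesis by (cases m) auto
qed

section \<open>Tail bounds\<close>

text \<open>
  Sign patterns are encoded by the set \<open>A\<close> of indices with sign \<open>1\<close>, so that they range over a
  power set.
\<close>

lemma sum_abs_eq_signed_sum:
  fixes x :: "'a \<Rightarrow> real"
  obtains A where "A \<subseteq> V" "(\<Sum>i\<in>V. \<bar>x i\<bar>) = (\<Sum>i\<in>V. (if i \<in> A then 1 else -1) * x i)"
proof
  show "{i \<in> V. x i \<ge> 0} \<subseteq> V" by auto
  show "(\<Sum>i\<in>V. \<bar>x i\<bar>) = (\<Sum>i\<in>V. (if i \<in> {i \<in> V. x i \<ge> 0} then 1 else -1) * x i)"
    by (intro sum.cong) auto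
qed

text \<open>
  The constant \<open>9 / 8\<close> is \<open>1\<close> for the union bound, from \<open>2 ^ m \<le> exp m\<close>, plus \<open>1 / 8\<close>
  for the exponential moment of each signed sum.
\<close>

lemma total_degree_deviation_tail:
  fixes m :: nat and c \<rho> :: real
  defines "q \<equiv> (real m - 1) * \<rho>"
  assumes \<rho>: "0 \<le> \<rho>" "\<rho> \<le> 1" and q: "1 / 4 \<le> q"
  shows "measure_pmf.prob (erdos_renyi m \<rho>)
           {G. (\<Sum>i=1..m. \<bar>real (vertex_degree G i) - q\<bar>) \<ge> c * real m * sqrt q}
         \<le> exp (- ((c / 4 - 9 / 8) * real m))"
proof -
  define s where "s = sqrt q"
  \<comment> \<open>An edge has weight at most \<open>2 \<theta>\<close> in absolute value; the choice of \<open>\<theta>\<close> makes this at most \<open>1\<close> because \<open>q \<ge> 1 / 4\<close>.\<close>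
  define \<theta> where "\<theta> = 1 / (4 * s)"
  have "sqrt ((1 / 2)\<^sup>2) \<le> s"
    unfolding s_def using q by (intro real_sqrt_le_mono) (simp add: power2_eq_square)
  then have s: "1 / 2 \<le> s" by simp
  have s2: "s\<^sup>2 = q" using q by (simp add: s_def)
  have \<theta>: "0 < \<theta>" "\<theta> \<le> 1 / 2" using s by (auto simp: \<theta>_def field_simps)
  define \<epsilon> where "\<epsilon> = (\<lambda>A (i::nat). if i \<in> A then 1 else -1 :: real)"
  define w where "w = (\<lambda>A e. \<Sum>i\<in>e. \<theta> * \<epsilon> A i)"
  define T where "T = (\<lambda>A. {G. (\<Sum>e\<in>all_edges m. w A e * (of_bool (e \<in> G) - \<rho>)) \<ge> c * real m / 4})"
  let ?P = "measure_pmf.prob (erdos_renyi m \<rho>)"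
  have abs_w: "\<bar>w A e\<bar> \<le> 2 * \<theta>" if "e \<in> all_edges m" for A e
  proof -
    have "\<bar>w A e\<bar> \<le> (\<Sum>i\<in>e. \<bar>\<theta> * \<epsilon> A i\<bar>)" unfolding w_def by (rule sum_abs)
    also have "\<dots> = (\<Sum>i\<in>e. \<theta>)" using \<theta> by (intro sum.cong) (auto simp: \<epsilon>_def)
    also have "\<dots> = 2 * \<theta>" using that by (simp add: all_edges_iff)
    finally show ?thesis .
  qed
  have T: "?P (T A) \<le> exp (real m / 8 - c * real m / 4)" for A
  proof -
    have "?P (T A) \<le> exp (\<rho> * (\<Sum>e\<in>all_edges m. (w A e)\<^sup>2) - c * real m / 4)"
      unfolding T_def
    proof (intro erdos_renyi_chernoff \<rho>)
      fix e assume "e \<in> all_edges m"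
      from abs_w[OF this, of A] show "w A e \<le> 1" using \<theta> by linarith
    qed
    also have "\<rho> * (\<Sum>e\<in>all_edges m. (w A e)\<^sup>2) \<le> \<rho> * (\<Sum>e\<in>all_edges m. (2 * \<theta>)\<^sup>2)"
    proof (intro mult_left_mono sum_mono \<rho>)
      fix e assume "e \<in> all_edges m"
      from abs_w[OF this, of A] show "(w A e)\<^sup>2 \<le> (2 * \<theta>)\<^sup>2"
        by (rule power2_le_iff_abs_le[THEN iffD2, rotated]) (use \<theta> in simp)
    qed
    also have "\<dots> = 2 * \<theta>\<^sup>2 * real m * q"
      by (simp add: card_all_edges q_def power_mult_distrib)
    also have "\<dots> = real m / 8"
      using s by (simp add: s2[symmetric] \<theta>_def power_divide power_mult_distrib)
    finally show ?thesis by simp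
  qed
  have "?P {G. (\<Sum>i=1..m. \<bar>real (vertex_degree G i) - q\<bar>) \<ge> c * real m * sqrt q}
      \<le> ?P (\<Union>A\<in>Pow {1..m}. T A)"
  proof (rule measure_pmf.finite_measure_mono_AE)
    show "AE G in measure_pmf (erdos_renyi m \<rho>).
        G \<in> {G. (\<Sum>i=1..m. \<bar>real (vertex_degree G i) - q\<bar>) \<ge> c * real m * sqrt q}
        \<longrightarrow> G \<in> (\<Union>A\<in>Pow {1..m}. T A)"
    proof (intro AE_pmfI impI)
      fix G assume "G \<in> set_pmf (erdos_renyi m \<rho>)"
        and "G \<in> {G. (\<Sum>i=1..m. \<bar>real (vertex_degree G i) - q\<bar>) \<ge> c * real m * sqrt q}"
      then have G: "G \<subseteq> all_edges m"
        and large: "c * real m * s \<le> (\<Sum>i=1..m. \<bar>real (vertex_degree G i) - q\<bar>)"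
        using set_erdos_renyi by (auto simp: s_def)
      obtain A where A: "A \<subseteq> {1..m}"
        "(\<Sum>i=1..m. \<bar>real (vertex_degree G i) - q\<bar>)
           = (\<Sum>i=1..m. \<epsilon> A i * (real (vertex_degree G i) - q))"
        unfolding \<epsilon>_def by (rule sum_abs_eq_signed_sum[of "{1..m}" "\<lambda>i. real (vertex_degree G i) - q"]) auto
      have "c * real m / 4 = \<theta> * (c * real m * s)" using s by (simp add: \<theta>_def)
      also have "\<dots> \<le> \<theta> * (\<Sum>i=1..m. \<epsilon> A i * (real (vertex_degree G i) - q))"
        using large \<theta> A(2) by (intro mult_left_mono) auto
      also have "\<dots> = (\<Sum>e\<in>all_edges m. w A e * (of_bool (e \<in> G) - \<rho>))"
        unfolding w_def q_def sum_weighted_degree_deviation[OF G, symmetric]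
        by (simp add: sum_distrib_left mult.assoc)
      finally show "G \<in> (\<Union>A\<in>Pow {1..m}. T A)" using A(1) by (auto simp: T_def)
    qed
  qed auto
  also have "\<dots> \<le> (\<Sum>A\<in>Pow {1..m}. ?P (T A))"
    by (rule measure_pmf.finite_measure_subadditive_finite) auto
  also have "\<dots> \<le> (\<Sum>A\<in>Pow {1..m}. exp (real m / 8 - c * real m / 4))"
    by (intro sum_mono T)
  also have "\<dots> = 2 ^ m * exp (real m / 8 - c * real m / 4)"
    by (simp add: card_Pow)
  also have "\<dots> \<le> exp 1 ^ m * exp (real m / 8 - c * real m / 4)"
    using exp_ge_add_one_self[of 1] by (intro mult_right_mono power_mono) auto
  also have "\<dots> = exp (- ((c / 4 - 9 / 8) * real m))"
    by (simp add: exp_of_nat_mult[symmetric] exp_add[symmetric] algebra_simps)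
  finally show ?thesis .
qed

text \<open>
  The event says that there are fewer than half the expected number of edges.  An edge weight
  \<open>- \<theta>\<close> gives the rate \<open>\<theta> / 2 - \<theta>\<^sup>2\<close> per expected edge, which is maximal at \<open>\<theta> = 1 / 4\<close>.
\<close>

lemma avg_degree_lower_tail:
  assumes \<rho>: "0 \<le> \<rho>" "\<rho> \<le> 1"
  shows "measure_pmf.prob (erdos_renyi m \<rho>) {G. avg_degree m G < (real m - 1) * \<rho> / 2}
         \<le> exp (- (real m * ((real m - 1) * \<rho>) / 32))"
proof -
  let ?E = "all_edges m" and ?P = "measure_pmf.prob (erdos_renyi m \<rho>)"
  define t where "t = \<rho> * real (card ?E) / 8"
  have "?P {G. avg_degree m G < (real m - 1) * \<rho> / 2}
      \<le> ?P {G. (\<Sum>e\<in>?E. - (1 / 4) * (of_bool (e \<in> G) - \<rho>)) \<ge> t}"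
  proof (rule measure_pmf.finite_measure_mono_AE)
    show "AE G in measure_pmf (erdos_renyi m \<rho>). G \<in> {G. avg_degree m G < (real m - 1) * \<rho> / 2}
        \<longrightarrow> G \<in> {G. (\<Sum>e\<in>?E. - (1 / 4) * (of_bool (e \<in> G) - \<rho>)) \<ge> t}"
    proof (intro AE_pmfI impI)
      fix G assume "G \<in> set_pmf (erdos_renyi m \<rho>)"
        and "G \<in> {G. avg_degree m G < (real m - 1) * \<rho> / 2}"
      then have G: "G \<subseteq> ?E" and small: "avg_degree m G < (real m - 1) * \<rho> / 2"
        using set_erdos_renyi by auto
      have "real (card G) \<le> \<rho> * real (card ?E) / 2"
      proof (cases "m = 0")
        case True
        then show ?thesis using G by (simp add: all_edges_def)
      next
        case False
        then show ?thesis using small sum_vertex_degree_eq_edges[OF G]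
          by (simp add: avg_degree_def card_all_edges field_simps)
      qed
      moreover have "(\<Sum>e\<in>?E. of_bool (e \<in> G)) = real (card G)"
        using G finite_all_edges[of m] by (simp add: of_bool_def sum.If_cases Int_absorb1 Int_absorb2)
      moreover have "(\<Sum>e\<in>?E. - (1 / 4) * (of_bool (e \<in> G) - \<rho>))
          = - (1 / 4) * ((\<Sum>e\<in>?E. of_bool (e \<in> G)) - real (card ?E) * \<rho>)"
        unfolding sum_distrib_left[symmetric] sum_subtractf by simp
      ultimately show "G \<in> {G. (\<Sum>e\<in>?E. - (1 / 4) * (of_bool (e \<in> G) - \<rho>)) \<ge> t}"
        unfolding t_def mem_Collect_eq by (simp only:) (simp add: field_simps)
    qed
  qed auto
  also have "\<dots> \<le> exp (\<rho> * (\<Sum>e\<in>?E. (- (1 / 4))\<^sup>2) - t)"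
    by (rule erdos_renyi_chernoff) (use \<rho> in auto)
  also have "\<dots> = exp (- (real m * ((real m - 1) * \<rho>) / 32))"
    by (simp add: t_def card_all_edges power2_eq_square field_simps)
  finally show ?thesis .
qed

text \<open>
  The factor \<open>4\<close> is \<open>2\<close> for moving the centre of the deviations from \<open>q\<close> to the average, which is
  within the mean deviation of \<open>q\<close>, times \<open>2\<close> for the smaller denominator.
\<close>

lemma avg_degree_deviation_le:
  fixes q :: real
  assumes "m > 0" "0 < q" "q / 2 \<le> avg_degree m G"
  shows "(\<Sum>i=1..m. \<bar>real (vertex_degree G i) - avg_degree m G\<bar> / (real m * avg_degree m G))
         \<le> 4 * (\<Sum>i=1..m. \<bar>real (vertex_degree G i) - q\<bar>) / (real m * q)"
proof -
  let ?d = "\<lambda>i. real (vertex_degree G i)" and ?a = "avg_degree m G"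
  let ?S = "\<Sum>i=1..m. \<bar>?d i - q\<bar>"
  have "real m * \<bar>q - ?a\<bar> = \<bar>\<Sum>i=1..m. (?d i - q)\<bar>"
    using assms(1) by (simp add: avg_degree_def sum_subtractf abs_minus_commute flip: abs_mult_pos')
      (simp add: field_simps)
  also have "\<dots> \<le> ?S" by (rule sum_abs)
  finally have mean: "real m * \<bar>q - ?a\<bar> \<le> ?S" .
  have "(\<Sum>i=1..m. \<bar>?d i - ?a\<bar>) \<le> (\<Sum>i=1..m. \<bar>?d i - q\<bar> + \<bar>q - ?a\<bar>)"
    by (intro sum_mono) linarith
  also have "\<dots> \<le> 2 * ?S" using mean by (simp add: sum.distrib)
  finally have "(\<Sum>i=1..m. \<bar>?d i - ?a\<bar>) / (real m * ?a) \<le> 2 * ?S / (real m * (q / 2))"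
    using assms by (intro frac_le mult_left_mono mult_pos_pos) (auto simp: sum_nonneg)
  then show ?thesis by (simp add: sum_divide_distrib)
qed

lemma mean_degree_ge_quarter:
  assumes "m \<ge> 2" "ln (real m) / real m \<le> \<rho>"
  shows "1 / 4 \<le> (real m - 1) * \<rho>"
proof -
  have "1 / 2 * (1 / 2) \<le> ((real m - 1) / real m) * ln (real m)"
  proof (rule mult_mono)
    show "1 / 2 \<le> (real m - 1) / real m" using assms by (simp add: field_simps)
    have "1 / 2 \<le> ln (2::real)" using ln_le_minus_one[of "1/2::real"] by (simp add: ln_div)
    also have "\<dots> \<le> ln (real m)" using assms by simp
    finally show "1 / 2 \<le> ln (real m)" .
  qed (use assms in auto)
  also have "\<dots> = (real m - 1) * (ln (real m) / real m)" by simp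
  also have "\<dots> \<le> (real m - 1) * \<rho>" using assms by (intro mult_left_mono) auto
  finally show ?thesis by simp
qed

section \<open>The two deviation bounds\<close>

text \<open>
  Bounding the sum by twice its larger term would not suffice: a factor \<open>2\<close> exceeds
  \<open>exp (x / 128 - x / 1600)\<close> for small \<open>x\<close>.  The first tail has to be taken so
  small that it is absorbed as a relative error.
\<close>

lemma exp_tails_absorb:
  fixes x :: real
  assumes "x \<ge> 2"
  shows "exp (- (98 * x)) + exp (- (x / 128)) \<le> exp (- (x / 1600))"
proof -
  have "exp (- (97 * x)) \<le> 1 / (97 * x)"
  proof -
    have "97 * x \<le> exp (97 * x)" using exp_ge_add_one_self[of "97 * x"] by linarith
    then show ?thesis using assms by (simp add: exp_minus field_simps)
  qed
  also have "\<dots> \<le> 1 / (97 * 2)" using assms by (intro frac_le) auto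
  also have "\<dots> \<le> (1 / 128 - 1 / 1600) * x" using assms by simp
  finally have small: "exp (- (97 * x)) \<le> (1 / 128 - 1 / 1600) * x" .
  have "exp (- (98 * x)) \<le> exp (- (x / 128)) * exp (- (97 * x))"
    using assms by (simp add: exp_add[symmetric])
  then have "exp (- (98 * x)) + exp (- (x / 128)) \<le> exp (- (x / 128)) * (1 + exp (- (97 * x)))"
    by (simp add: algebra_simps)
  also have "\<dots> \<le> exp (- (x / 128)) * exp ((1 / 128 - 1 / 1600) * x)"
    using small exp_ge_add_one_self[of "(1 / 128 - 1 / 1600) * x"]
    by (intro mult_left_mono order.trans[OF add_left_mono[OF small]]) auto
  also have "\<dots> = exp (- (x / 1600))"
    by (simp add: exp_add[symmetric] algebra_simps)
  finally show ?thesis .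
qed

theorem lemma6p2:
  shows "\<exists>c\<^sub>0::real. c\<^sub>0 > 0 \<and>
    (\<forall>(m::nat) (\<rho>::real). m \<ge> 2 \<longrightarrow> ln (real m) / real m \<le> \<rho> \<longrightarrow> \<rho> \<le> 1 \<longrightarrow>
      measure_pmf.prob (erdos_renyi m \<rho>)
        {G. (\<Sum>i = 1..m. \<bar>real (vertex_degree G i) - (real m - 1) * \<rho>\<bar> / (real m * (real m - 1) * \<rho>))
              \<ge> c\<^sub>0 / sqrt ((real m - 1) * \<rho>)}
        \<le> exp (- (real m / c\<^sub>0)) \<and>
      measure_pmf.prob (erdos_renyi m \<rho>)
        {G. (\<Sum>i = 1..m. \<bar>real (vertex_degree G i) - avg_degree m G\<bar> / (real m * avg_degree m G))
              \<ge> c\<^sub>0 / sqrt ((real m - 1) * \<rho>)}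
        \<le> exp (- (real m / c\<^sub>0)))"
  \<comment> \<open>The second bound uses the tail of the total deviation at \<open>c = 1600 / 4 = 400\<close>, where its rate \<open>400 / 4 - 9 / 8\<close> exceeds \<open>98\<close>.\<close>
proof (intro exI[of _ 1600] conjI allI impI)
  fix m :: nat and \<rho> :: real
  assume m: "m \<ge> 2" and lower: "ln (real m) / real m \<le> \<rho>" and upper: "\<rho> \<le> 1"
  let ?P = "measure_pmf.prob (erdos_renyi m \<rho>)"
  define q where "q = (real m - 1) * \<rho>"
  define S where "S = (\<lambda>G. \<Sum>i=1..m. \<bar>real (vertex_degree G i) - q\<bar>)"
  have q: "1 / 4 \<le> q" unfolding q_def using m lower by (rule mean_degree_ge_quarter)
  have "0 \<le> ln (real m) / real m" using m by simp
  then have \<rho>: "0 \<le> \<rho>" using lower by linarith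
  have sq: "sqrt q * sqrt q = q" "0 < sqrt q" using q by auto
  have tail: "?P {G. S G \<ge> c * real m * sqrt q} \<le> exp (- ((c / 4 - 9 / 8) * real m))" for c
    using total_degree_deviation_tail[OF \<rho> upper, of m c] q by (simp add: S_def q_def)
  have scale: "c / sqrt q \<le> x / (real m * q) \<longleftrightarrow> c * real m * sqrt q \<le> x" for c x
  proof -
    have "c / sqrt q = (c * real m * sqrt q) / (real m * q)"
      using sq m q by (simp add: divide_simps)
    moreover have "0 < real m * q" using m q by simp
    ultimately show ?thesis by (simp only: divide_le_cancel) auto
  qed
  show "?P {G. (\<Sum>i = 1..m. \<bar>real (vertex_degree G i) - (real m - 1) * \<rho>\<bar>
            / (real m * (real m - 1) * \<rho>)) \<ge> 1600 / sqrt ((real m - 1) * \<rho>)}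
        \<le> exp (- (real m / 1600))"
  proof -
    have "{G. (\<Sum>i = 1..m. \<bar>real (vertex_degree G i) - (real m - 1) * \<rho>\<bar>
            / (real m * (real m - 1) * \<rho>)) \<ge> 1600 / sqrt ((real m - 1) * \<rho>)}
        = {G. S G \<ge> 1600 * real m * sqrt q}"
      unfolding scale[symmetric] S_def sum_divide_distrib unfolding q_def mult.assoc ..
    then show ?thesis using tail[of 1600] by (simp add: order.trans)
  qed
  show "?P {G. (\<Sum>i = 1..m. \<bar>real (vertex_degree G i) - avg_degree m G\<bar>
            / (real m * avg_degree m G)) \<ge> 1600 / sqrt ((real m - 1) * \<rho>)}
        \<le> exp (- (real m / 1600))" (is "measure_pmf.prob _ ?D \<le> _")
  proof -
    have "?D \<subseteq> {G. S G \<ge> 400 * real m * sqrt q} \<union> {G. avg_degree m G < q / 2}"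
    proof
      fix G assume "G \<in> ?D"
      then have G: "1600 / sqrt q \<le> (\<Sum>i = 1..m. \<bar>real (vertex_degree G i) - avg_degree m G\<bar>
            / (real m * avg_degree m G))" by (simp add: q_def)
      show "G \<in> {G. S G \<ge> 400 * real m * sqrt q} \<union> {G. avg_degree m G < q / 2}"
      proof (cases "avg_degree m G < q / 2")
        case False
        then have "1600 / sqrt q \<le> 4 * S G / (real m * q)"
          using G avg_degree_deviation_le[of m q G] m q unfolding S_def by linarith
        then show ?thesis unfolding scale by simp
      qed simp
    qed
    then have "?P ?D \<le> ?P ({G. S G \<ge> 400 * real m * sqrt q} \<union> {G. avg_degree m G < q / 2})"
      by (intro measure_pmf.finite_measure_mono) auto
    also have "\<dots> \<le> ?P {G. S G \<ge> 400 * real m * sqrt q} + ?P {G. avg_degree m G < q / 2}"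
      by (rule measure_Un_le) auto
    also have "\<dots> \<le> exp (- (98 * real m)) + exp (- (real m / 128))"
    proof (rule add_mono)
      show "?P {G. S G \<ge> 400 * real m * sqrt q} \<le> exp (- (98 * real m))"
        by (rule order.trans[OF tail]) simp
      have "?P {G. avg_degree m G < q / 2} \<le> exp (- (real m * q / 32))"
        unfolding q_def by (rule avg_degree_lower_tail[OF \<rho> upper])
      also have "\<dots> \<le> exp (- (real m / 128))"
        using mult_left_mono[OF q, of "real m"] by simp
      finally show "?P {G. avg_degree m G < q / 2} \<le> exp (- (real m / 128))" .
    qed
    also have "\<dots> \<le> exp (- (real m / 1600))"
      using m by (intro exp_tails_absorb) simp
    finally show ?thesis .
  qed
qed simp

end
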